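(* Let $\delta_1,\delta_2,\delta_3$ and $x_1>x_2>x_3$ be real numbers, let $W(\cdot)$ be a standard scalar Brownian motion, and let $R_1(\cdot)\ge R_2(\cdot)\ge R_3(\cdot)$, $G(\cdot)$, $H(\cdot)$ be the processes constructed from $W(\cdot)$ as described in the context. Then, with probability one, $$R_1(t)-R_3(t)=G(t)+H(t)>0\qquad\text{for all } t\in[0,\infty).$$
   Context: Let $W(\cdot)$ be a standard scalar Brownian motion, and let $(A(\cdot),\Gamma(\cdot))$ be the unique pair of continuous, nondecreasing processes, adapted to the smallest right-continuous filtration to which $W(\cdot)$ is adapted, with $A(0)=\Gamma(0)=0$ and, for $0\le t<\infty$, $$A(t)=\max_{0\le s\le t}\Big(-(x_1-x_2)+(\delta_2-\delta_1)s+W(s)+\tfrac12\Gamma(s)\Big)^+,$$ $$\Gamma(t)=\max_{0\le s\le t}\Big(-(x_2-x_3)+(\delta_3-\delta_2)s-W(s)+\tfrac12 A(s)\Big)^+$$ (existence and uniqueness of this pair is a known result of Harrison and Reiman). Define $$R_1(t)=x_1+\delta_1t+\tfrac12A(t),\qquad R_2(t)=x_2+\delta_2t+W(t)-\tfrac12A(t)+\tfrac12\Gamma(t),\qquad R_3(t)=x_3+\delta_3t-\tfrac12\Gamma(t),$$ and the gaps $G(t)=R_1(t)-R_2(t)\ge0$, $H(t)=R_2(t)-R_3(t)\ge0$. *)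

theory Defs
  imports "HOL-Probability.Probability"
begin

text \<open>
  Processes are functions \<open>real \<Rightarrow> 'a \<Rightarrow> real\<close> (time first) of which only the values at
  times \<open>t \<ge> 0\<close> matter. Path properties are required almost surely.
\<close>

locale standard_brownian_motion = prob_space M
  for M :: "'a measure" and W :: "real \<Rightarrow> 'a \<Rightarrow> real" +
  assumes measurable_W: "\<And>t. 0 \<le> t \<Longrightarrow> W t \<in> borel_measurable M"
    and start_W: "AE \<omega> in M. W 0 \<omega> = 0"
    and continuous_W: "AE \<omega> in M. continuous_on {0..} (\<lambda>t. W t \<omega>)"
    and normal_increments: "\<And>s t. 0 \<le> s \<Longrightarrow> s < t \<Longrightarrow>
      distributed M lborel (\<lambda>\<omega>. W t \<omega> - W s \<omega>) (normal_density 0 (sqrt (t - s)))"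
    and indep_increments: "\<And>(n :: nat) \<tau>. 0 \<le> \<tau> 0 \<Longrightarrow> strict_mono_on {..n} \<tau> \<Longrightarrow>
      indep_vars (\<lambda>_. borel) (\<lambda>i \<omega>. W (\<tau> (Suc i)) \<omega> - W (\<tau> i) \<omega>) {..<n}"

definition adapted :: "(real \<Rightarrow> 'a measure) \<Rightarrow> (real \<Rightarrow> 'a \<Rightarrow> real) \<Rightarrow> bool" where
  "adapted F X \<longleftrightarrow> (\<forall>t\<ge>0. X t \<in> borel_measurable (F t))"

definition right_continuous_filtration :: "(real \<Rightarrow> 'a measure) \<Rightarrow> bool" where
  "right_continuous_filtration F \<longleftrightarrow> (\<forall>t\<ge>0. sets (F t) = (\<Inter>u\<in>{t<..}. sets (F u)))"

definition natural_filtration :: "'a set \<Rightarrow> (real \<Rightarrow> 'a \<Rightarrow> real) \<Rightarrow> real \<Rightarrow> 'a measure" where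
  "natural_filtration \<Omega> X t =
     sigma \<Omega> {X s -` B \<inter> \<Omega> | s B. 0 \<le> s \<and> s \<le> t \<and> B \<in> sets borel}"

text \<open>The smallest right-continuous filtration to which \<open>X\<close> is adapted, in the usual form
  of the right limits of the natural filtration; the lemmas below justify the name.\<close>

definition right_filtration :: "'a set \<Rightarrow> (real \<Rightarrow> 'a \<Rightarrow> real) \<Rightarrow> real \<Rightarrow> 'a measure" where
  "right_filtration \<Omega> X t = sigma \<Omega> (\<Inter>u\<in>{t<..}. sets (natural_filtration \<Omega> X u))"

lemma space_natural_filtration: "space (natural_filtration \<Omega> X t) = \<Omega>"
  unfolding natural_filtration_def by (rule space_measure_of) auto

lemma sets_natural_filtration:
  "sets (natural_filtration \<Omega> X t) =
     sigma_sets \<Omega> {X s -` B \<inter> \<Omega> | s B. 0 \<le> s \<and> s \<le> t \<and> B \<in> sets borel}"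
  unfolding natural_filtration_def by (rule sets_measure_of) auto

lemma sets_natural_filtration_mono:
  "s \<le> t \<Longrightarrow> sets (natural_filtration \<Omega> X s) \<subseteq> sets (natural_filtration \<Omega> X t)"
  unfolding sets_natural_filtration by (rule sigma_sets_mono') (blast intro: order_trans)

lemma space_right_filtration: "space (right_filtration \<Omega> X t) = \<Omega>"
  unfolding right_filtration_def
proof (rule space_measure_of)
  show "(\<Inter>u\<in>{t<..}. sets (natural_filtration \<Omega> X u)) \<subseteq> Pow \<Omega>"
    using INT_lower[of "t + 1" "{t<..}" "\<lambda>u. sets (natural_filtration \<Omega> X u)"]
      sets.space_closed[of "natural_filtration \<Omega> X (t + 1)"]
    unfolding space_natural_filtration by simp
qed

lemma sets_right_filtration:
  "sets (right_filtration \<Omega> X t) = (\<Inter>u\<in>{t<..}. sets (natural_filtration \<Omega> X u))"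
proof -
  let ?S = "\<Inter>u\<in>{t<..}. sets (natural_filtration \<Omega> X u)"
  have sub: "?S \<subseteq> Pow \<Omega>"
    using INT_lower[of "t + 1" "{t<..}" "\<lambda>u. sets (natural_filtration \<Omega> X u)"]
      sets.space_closed[of "natural_filtration \<Omega> X (t + 1)"]
    unfolding space_natural_filtration by simp
  have "sigma_sets \<Omega> ?S \<subseteq> sets (natural_filtration \<Omega> X u)" if "t < u" for u
  proof -
    have "?S \<subseteq> sets (natural_filtration \<Omega> X u)"
      using that by (intro INT_lower) simp
    from sets.sigma_sets_subset[OF this] show ?thesis
      by (simp only: space_natural_filtration)
  qed
  then have "sigma_sets \<Omega> ?S \<subseteq> ?S"
    by (intro INT_greatest) simp
  then have "sigma_sets \<Omega> ?S = ?S"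
    by (intro equalityI subsetI sigma_sets.Basic) (rule subsetD)
  then show ?thesis
    unfolding right_filtration_def using sets_measure_of[OF sub] by simp
qed

lemma filtration_right_filtration: "filtration \<Omega> (right_filtration \<Omega> X)"
proof
  show "sets (right_filtration \<Omega> X s) \<subseteq> sets (right_filtration \<Omega> X t)" if "s \<le> t" for s t
    unfolding sets_right_filtration using that by (intro INT_anti_mono) auto
qed (rule space_right_filtration)

lemma right_continuous_right_filtration:
  "right_continuous_filtration (right_filtration \<Omega> X)"
  unfolding right_continuous_filtration_def sets_right_filtration
proof (intro allI impI equalityI INT_greatest)
  fix t u :: real assume "u \<in> {t<..}"
  then obtain v where "t < v" "v < u" using dense by auto
  then show "(\<Inter>v\<in>{t<..}. \<Inter>u\<in>{v<..}. sets (natural_filtration \<Omega> X u))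
      \<subseteq> sets (natural_filtration \<Omega> X u)"
    by (intro INF_lower2[of v] INT_lower) auto
qed (rule INT_lower, simp)

lemma adapted_right_filtration: "adapted (right_filtration \<Omega> X) X"
  unfolding adapted_def
proof (intro allI impI measurableI)
  fix t :: real and B :: "real set" assume "0 \<le> t" "B \<in> sets borel"
  then show "X t -` B \<inter> space (right_filtration \<Omega> X t) \<in> sets (right_filtration \<Omega> X t)"
    unfolding sets_right_filtration space_right_filtration sets_natural_filtration
    by (intro INT_I sigma_sets.Basic CollectI exI[of _ t] exI[of _ B]) simp
qed simp

lemma right_filtration_least:
  assumes F: "filtration \<Omega> F" "right_continuous_filtration F" "adapted F X" and t: "0 \<le> t"
  shows "sets (right_filtration \<Omega> X t) \<subseteq> sets (F t)"
proof -
  interpret filtration \<Omega> F by (rule F)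
  have "sets (natural_filtration \<Omega> X u) \<subseteq> sets (F u)" for u
  proof -
    have "X s -` B \<inter> \<Omega> \<in> sets (F u)" if "0 \<le> s" "s \<le> u" "B \<in> sets borel" for s B
    proof -
      have "X s \<in> borel_measurable (F s)"
        using F(3) that(1) by (simp add: adapted_def)
      then have "X s -` B \<inter> \<Omega> \<in> sets (F s)"
        using measurable_sets[of "X s" "F s" borel B] that(3) by (simp add: space_F)
      then show ?thesis
        using sets_F_mono[OF that(2)] by blast
    qed
    then have "{X s -` B \<inter> \<Omega> | s B. 0 \<le> s \<and> s \<le> u \<and> B \<in> sets borel} \<subseteq> sets (F u)"
      by blast
    then show ?thesis
      unfolding sets_natural_filtration space_F[of u, symmetric]
      by (rule sets.sigma_sets_subset)
  qed
  then have "(\<Inter>u\<in>{t<..}. sets (natural_filtration \<Omega> X u)) \<subseteq> (\<Inter>u\<in>{t<..}. sets (F u))"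
    by (intro INT_anti_mono) auto
  then show ?thesis
    using F(2) t unfolding right_continuous_filtration_def sets_right_filtration by simp
qed

text \<open>The defining property of the pair \<open>(A, \<Gamma>)\<close> driven by \<open>W\<close>. On continuous paths the suprema
  over \<open>[0, t]\<close> are attained, so that \<open>SUP\<close> is the maximum of the positive parts \<open>max 0 (\<dots>)\<close>.
  (\<open>Max\<close> is meaningful for finite sets only.)\<close>

definition regulator_pair ::
    "'a measure \<Rightarrow> (real \<Rightarrow> 'a \<Rightarrow> real) \<Rightarrow> real \<Rightarrow> real \<Rightarrow> real \<Rightarrow> real \<Rightarrow> real \<Rightarrow> real \<Rightarrow>
     (real \<Rightarrow> 'a \<Rightarrow> real) \<Rightarrow> (real \<Rightarrow> 'a \<Rightarrow> real) \<Rightarrow> bool" where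
  "regulator_pair M W \<delta>\<^sub>1 \<delta>\<^sub>2 \<delta>\<^sub>3 x\<^sub>1 x\<^sub>2 x\<^sub>3 A \<Gamma> \<longleftrightarrow>
     adapted (right_filtration (space M) W) A \<and>
     adapted (right_filtration (space M) W) \<Gamma> \<and>
     (AE \<omega> in M.
        continuous_on {0..} (\<lambda>t. A t \<omega>) \<and> mono_on {0..} (\<lambda>t. A t \<omega>) \<and> A 0 \<omega> = 0 \<and>
        continuous_on {0..} (\<lambda>t. \<Gamma> t \<omega>) \<and> mono_on {0..} (\<lambda>t. \<Gamma> t \<omega>) \<and> \<Gamma> 0 \<omega> = 0 \<and>
        (\<forall>t\<ge>0.
           A t \<omega> = (SUP s\<in>{0..t}. max 0 (- (x\<^sub>1 - x\<^sub>2) + (\<delta>\<^sub>2 - \<delta>\<^sub>1) * s + W s \<omega> + \<Gamma> s \<omega> / 2)) \<and>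
           \<Gamma> t \<omega> = (SUP s\<in>{0..t}. max 0 (- (x\<^sub>2 - x\<^sub>3) + (\<delta>\<^sub>3 - \<delta>\<^sub>2) * s - W s \<omega> + A s \<omega> / 2))))"

definition R1 :: "real \<Rightarrow> real \<Rightarrow> (real \<Rightarrow> 'a \<Rightarrow> real) \<Rightarrow> real \<Rightarrow> 'a \<Rightarrow> real" where
  "R1 \<delta>\<^sub>1 x\<^sub>1 A t \<omega> = x\<^sub>1 + \<delta>\<^sub>1 * t + A t \<omega> / 2"

definition R2 :: "(real \<Rightarrow> 'a \<Rightarrow> real) \<Rightarrow> real \<Rightarrow> real \<Rightarrow> (real \<Rightarrow> 'a \<Rightarrow> real) \<Rightarrow>
    (real \<Rightarrow> 'a \<Rightarrow> real) \<Rightarrow> real \<Rightarrow> 'a \<Rightarrow> real" where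
  "R2 W \<delta>\<^sub>2 x\<^sub>2 A \<Gamma> t \<omega> = x\<^sub>2 + \<delta>\<^sub>2 * t + W t \<omega> - A t \<omega> / 2 + \<Gamma> t \<omega> / 2"

definition R3 :: "real \<Rightarrow> real \<Rightarrow> (real \<Rightarrow> 'a \<Rightarrow> real) \<Rightarrow> real \<Rightarrow> 'a \<Rightarrow> real" where
  "R3 \<delta>\<^sub>3 x\<^sub>3 \<Gamma> t \<omega> = x\<^sub>3 + \<delta>\<^sub>3 * t - \<Gamma> t \<omega> / 2"

definition gap :: "(real \<Rightarrow> 'a \<Rightarrow> real) \<Rightarrow> (real \<Rightarrow> 'a \<Rightarrow> real) \<Rightarrow> real \<Rightarrow> 'a \<Rightarrow> real" where
  "gap X Y t \<omega> = X t \<omega> - Y t \<omega>"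

end

theory Submission
  imports Defs
begin

text \<open>
  Write \<open>S = G + H = (x\<^sub>1 - x\<^sub>3) - (\<delta>\<^sub>3 - \<delta>\<^sub>1) t + (A + \<Gamma>) / 2\<close>. The Brownian terms cancel in \<open>S\<close>,
  and \<open>A + \<Gamma>\<close> only pushes upwards, so \<open>S\<close> falls at most at the linear speed
  \<open>\<mu> = \<bar>\<delta>\<^sub>3 - \<delta>\<^sub>1\<bar> + 1\<close>. Suppose that \<open>S\<close> reaches \<open>0\<close>. Between the last passage through a
  small level \<open>\<epsilon>\<close> and this zero, \<open>S\<close> stays below \<open>\<epsilon>\<close> for a time at least \<open>\<epsilon> / \<mu>\<close>. During
  the first \<open>\<epsilon> / \<mu>\<close> units of that time both gaps lie in \<open>[0, \<epsilon>]\<close>, and \<open>A + \<Gamma>\<close> can grow by at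
  most \<open>2 \<epsilon>\<close>, as \<open>S\<close> would otherwise climb back above \<open>\<epsilon>\<close>. Since \<open>W\<close> is an affine
  combination of time, \<open>G\<close>, \<open>A\<close> and \<open>\<Gamma>\<close>, it moves by \<open>O(\<epsilon>)\<close> over a time of order \<open>\<epsilon>\<close>
  (\<open>collapse_slows_driver\<close>).

  A Brownian path does not do this, because over a time \<open>\<epsilon>\<close> it typically moves by \<open>\<surd>\<epsilon>\<close>. On a grid
  of mesh \<open>h\<close>, an increment is at most \<open>C h\<close> with probability at most \<open>C \<surd>h\<close>, so three
  consecutive increments are that small with probability at most \<open>C\<^sup>3 h \<surd>h\<close>. As there are only about
  \<open>T / h\<close> cells in \<open>[0, T]\<close>, the probability that this happens anywhere tends to \<open>0\<close> with \<open>h\<close>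
  (\<open>AE_not_eventually_slow\<close>). Three is the least number of increments for which the union bound
  works.
\<close>

section \<open>Brownian motion is nowhere slow\<close>

text \<open>The crude bound \<open>4 \<le> 2 \<pi>\<close> on the peak of the density gives a constant without \<open>\<pi>\<close>.\<close>

lemma normal_density_le: "0 < \<sigma> \<Longrightarrow> normal_density \<mu> \<sigma> x \<le> 1 / (2 * \<sigma>)"
proof -
  assume s: "0 < \<sigma>"
  have "2 * \<sigma> = sqrt (4 * \<sigma>\<^sup>2)"
    using s by (simp add: real_sqrt_mult)
  also have "\<dots> \<le> sqrt (2 * pi * \<sigma>\<^sup>2)"
    using pi_gt3 by (intro real_sqrt_le_mono mult_right_mono) auto
  finally have *: "2 * \<sigma> \<le> sqrt (2 * pi * \<sigma>\<^sup>2)" .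
  have "normal_density \<mu> \<sigma> x \<le> 1 / sqrt (2 * pi * \<sigma>\<^sup>2) * 1"
    unfolding normal_density_def by (intro mult_left_mono) (use s in auto)
  also have "\<dots> \<le> 1 / (2 * \<sigma>)"
    using * s by (simp add: frac_le)
  finally show ?thesis .
qed

context standard_brownian_motion
begin

lemma prob_small_increment_le:
  assumes "0 \<le> s" "s < t" "0 \<le> c"
  shows "prob {\<omega>\<in>space M. \<bar>W t \<omega> - W s \<omega>\<bar> \<le> c} \<le> c / sqrt (t - s)"
proof -
  let ?X = "\<lambda>\<omega>. W t \<omega> - W s \<omega>" and ?f = "normal_density 0 (sqrt (t - s))"
  have "emeasure M {\<omega>\<in>space M. \<bar>?X \<omega>\<bar> \<le> c} = emeasure M (?X -` {-c..c} \<inter> space M)"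
    by (intro arg_cong[where f="emeasure M"]) auto
  also have "\<dots> = (\<integral>\<^sup>+x. ennreal (?f x) * indicator {-c..c} x \<partial>lborel)"
    by (rule distributed_emeasure[OF normal_increments[OF assms(1,2)]]) simp
  also have "\<dots> \<le> (\<integral>\<^sup>+x. ennreal (1 / (2 * sqrt (t - s))) * indicator {-c..c} x \<partial>lborel)"
    by (intro nn_integral_mono mult_right_mono ennreal_leI normal_density_le) (use assms in auto)
  also have "\<dots> = ennreal (1 / (2 * sqrt (t - s))) * ennreal (2 * c)"
    using assms by (subst nn_integral_cmult_indicator) auto
  also have "\<dots> = ennreal (c / sqrt (t - s))"
    using assms by (subst ennreal_mult[symmetric]) auto
  finally show ?thesis
    unfolding emeasure_eq_measure by (subst (asm) ennreal_le_iff) (use assms in auto)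
qed

lemma prob_consecutive_small_increments_le:
  assumes "0 \<le> a" "0 < h" "0 \<le> c"
  shows "prob {\<omega>\<in>space M. \<forall>j<n. \<bar>W (a + real (Suc j) * h) \<omega> - W (a + real j * h) \<omega>\<bar> \<le> c}
    \<le> (c / sqrt h) ^ n"
proof (cases "n = 0")
  case True
  then show ?thesis by simp
next
  case False
  define \<tau> where "\<tau> j = a + real j * h" for j
  let ?X = "\<lambda>j \<omega>. W (\<tau> (Suc j)) \<omega> - W (\<tau> j) \<omega>"
  have "indep_vars (\<lambda>_. borel) ?X {..<n}"
    using assms by (intro indep_increments) (auto simp: \<tau>_def strict_mono_on_def)
  then have "prob (\<Inter>j\<in>{..<n}. ?X j -` {-c..c} \<inter> space M)
      = (\<Prod>j<n. prob (?X j -` {-c..c} \<inter> space M))"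
    using False by (intro indep_varsD) (auto simp: lessThan_empty_iff)
  also have "\<dots> \<le> (\<Prod>j<n. c / sqrt h)"
  proof (intro prod_mono conjI)
    fix j
    have "0 \<le> \<tau> j" "\<tau> j < \<tau> (Suc j)" "\<tau> (Suc j) - \<tau> j = h"
      using assms by (auto simp: \<tau>_def algebra_simps)
    from prob_small_increment_le[OF this(1,2) assms(3)] this(3)
    have "prob {\<omega>\<in>space M. \<bar>?X j \<omega>\<bar> \<le> c} \<le> c / sqrt h"
      by simp
    also have "{\<omega>\<in>space M. \<bar>?X j \<omega>\<bar> \<le> c} = ?X j -` {-c..c} \<inter> space M"
      by auto
    finally show "prob (?X j -` {-c..c} \<inter> space M) \<le> c / sqrt h" .
  qed simp
  also have "(\<Inter>j\<in>{..<n}. ?X j -` {-c..c} \<inter> space M) = {\<omega>\<in>space M. \<forall>j<n. \<bar>?X j \<omega>\<bar> \<le> c}"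
    using False by (force simp: abs_le_iff)
  finally show ?thesis
    by (simp add: \<tau>_def)
qed

text \<open>The event to which a collapse of the gaps leads. It is stated on a fixed grid, rather than on an
  arbitrary time interval, so that it is a finite union of events with explicit probability bounds.\<close>

definition slow_near :: "real \<Rightarrow> real \<Rightarrow> real \<Rightarrow> 'a set" where
  "slow_near C T h = {\<omega>\<in>space M. \<exists>i::nat. real i * h \<le> T \<and>
     (\<forall>j<3. \<bar>W (real i * h + real (Suc j) * h) \<omega> - W (real i * h + real j * h) \<omega>\<bar> \<le> C * h)}"

lemma slow_near_sets:
  assumes "0 < h"
  shows "slow_near C T h \<in> events"
proof -
  have [measurable]: "W (real i * h + real j * h) \<in> borel_measurable M" for i j
    using assms by (intro measurable_W) simp
  show ?thesis
    unfolding slow_near_def by measurable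
qed

text \<open>A union bound over the at most \<open>T / h + 1\<close> starting cells. The factor \<open>1 / h\<close> costs one power of
  \<open>h\<close>, and the three small increments gain \<open>h \<surd>h\<close>.\<close>

lemma prob_slow_near_le:
  assumes "0 < h" "0 \<le> C" "0 \<le> T"
  shows "prob (slow_near C T h) \<le> (T + h) * C ^ 3 * sqrt h"
proof -
  define N where "N = Suc (nat \<lfloor>T / h\<rfloor>)"
  define E where "E i = {\<omega>\<in>space M. \<forall>j<3. \<bar>W (real i * h + real (Suc j) * h) \<omega>
    - W (real i * h + real j * h) \<omega>\<bar> \<le> C * h}" for i
  have [measurable]: "W (real i * h + real j * h) \<in> borel_measurable M" for i j
    using assms by (intro measurable_W) simp
  have E: "E i \<in> events" for i
    unfolding E_def by measurable
  have "i < N" if "real i * h \<le> T" for i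
  proof -
    have "real i \<le> T / h"
      using that assms by (simp add: field_simps)
    then show ?thesis
      unfolding N_def by (simp add: le_nat_floor less_Suc_eq_le)
  qed
  then have "slow_near C T h \<subseteq> (\<Union>i<N. E i)"
    by (auto simp: slow_near_def E_def)
  then have "prob (slow_near C T h) \<le> prob (\<Union>i<N. E i)"
    using E by (intro finite_measure_mono) auto
  also have "\<dots> \<le> (\<Sum>i<N. prob (E i))"
    using E by (intro finite_measure_subadditive_finite) auto
  also have "\<dots> \<le> (\<Sum>i<N. (C * h / sqrt h) ^ 3)"
    unfolding E_def using assms by (intro sum_mono prob_consecutive_small_increments_le) auto
  also have "\<dots> = real N * (C * sqrt h) ^ 3"
    using assms by (simp add: real_div_sqrt flip: times_divide_eq_right)
  also have "\<dots> \<le> (T / h + 1) * (C * sqrt h) ^ 3"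
    using assms by (intro mult_right_mono) (auto simp: N_def)
  also have "\<dots> = (T + h) * C ^ 3 * sqrt h"
    using assms by (simp add: power3_eq_cube field_simps)
  finally show ?thesis .
qed

text \<open>No summability is required: a path that is slow at every scale \<open>1 / (n + 1)\<close> with \<open>n \<ge> N\<close> lies in
  an event contained in each single \<open>slow_near\<close> event, whose probability tends to \<open>0\<close>.\<close>

lemma AE_not_eventually_slow:
  assumes "0 \<le> C"
  shows "AE \<omega> in M. \<forall>(m::nat) (N::nat). \<exists>n\<ge>N. \<omega> \<notin> slow_near C (real m) (1 / real (Suc n))"
proof (subst AE_all_countable, intro allI, subst AE_all_countable, intro allI)
  fix m N :: nat
  let ?h = "\<lambda>n. 1 / real (Suc n)"
  let ?B = "\<Inter>n\<in>{N..}. slow_near C (real m) (?h n)"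
  have meas: "?B \<in> events"
    by (intro sets.countable_INT') (auto intro: slow_near_sets)
  have "(\<lambda>n. (real m + ?h n) * C ^ 3 * sqrt (?h n)) \<longlonglongrightarrow> (real m + 0) * C ^ 3 * sqrt 0"
    by (intro tendsto_intros LIMSEQ_Suc[OF lim_1_over_n])
  moreover have "prob ?B \<le> (real m + ?h n) * C ^ 3 * sqrt (?h n)" if "n \<ge> N" for n
  proof -
    have "prob ?B \<le> prob (slow_near C (real m) (?h n))"
      using that by (intro finite_measure_mono slow_near_sets) auto
    also have "\<dots> \<le> (real m + ?h n) * C ^ 3 * sqrt (?h n)"
      using assms by (intro prob_slow_near_le) auto
    finally show ?thesis .
  qed
  ultimately have "prob ?B \<le> 0"
    by (intro LIMSEQ_le_const[where X = "\<lambda>n. (real m + ?h n) * C ^ 3 * sqrt (?h n)"]) auto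
  then have "?B \<in> null_sets M"
    using meas by (simp add: null_sets_def emeasure_eq_measure measure_le_0_iff)
  then show "AE \<omega> in M. \<exists>n\<ge>N. \<omega> \<notin> slow_near C (real m) (?h n)"
    by (rule AE_I') auto
qed

end

section \<open>A collapse of the total gap slows the driving path down\<close>

lemma last_passage:
  fixes S :: "real \<Rightarrow> real"
  assumes cont: "continuous_on {u..v} S" and "u \<le> v" "S v < \<epsilon>" "\<epsilon> \<le> S u"
  obtains a where "a \<in> {u..v}" "S a = \<epsilon>" "\<And>t. t \<in> {a..v} \<Longrightarrow> S t \<le> \<epsilon>"
proof -
  let ?Z = "{t\<in>{u..v}. S t \<in> {\<epsilon>}}"
  have "?Z \<noteq> {}"
    using IVT2'[of S v \<epsilon> u] assms by auto
  moreover have "compact ?Z"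
  proof -
    have "closed ({u..v} \<inter> S -` {\<epsilon>})"
      using cont by (intro continuous_closed_preimage) auto
    moreover have "{u..v} \<inter> S -` {\<epsilon>} = ?Z" by auto
    ultimately show ?thesis
      by (auto simp: compact_eq_bounded_closed intro: bounded_subset[of "{u..v}"])
  qed
  ultimately have "\<exists>a\<in>?Z. \<forall>t\<in>?Z. t \<le> a"
    by (intro compact_attains_sup)
  then obtain a where a: "a \<in> ?Z" and max: "\<And>t. t \<in> ?Z \<Longrightarrow> t \<le> a"
    by blast
  have "S t \<le> \<epsilon>" if "t \<in> {a..v}" for t
  proof (rule ccontr)
    assume t: "\<not> S t \<le> \<epsilon>"
    have "\<exists>r\<ge>t. r \<le> v \<and> S r = \<epsilon>"
    proof (rule IVT2')
      show "continuous_on {t..v} S"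
        using that a by (intro continuous_on_subset[OF cont]) auto
    qed (use t that assms in auto)
    then obtain r where r: "t \<le> r" "r \<le> v" "S r = \<epsilon>"
      by blast
    then have "r \<le> a"
      using that a by (intro max) auto
    then have "t = a"
      using r that by simp
    with a t show False
      by simp
  qed
  with a that show thesis by auto
qed

text \<open>This is the pathwise half of the argument, where \<open>S\<close> is the total gap and \<open>w\<close> the driving path.
  The level is \<open>\<epsilon> = 4 \<mu> h\<close>, so that the descent from \<open>\<epsilon>\<close> to \<open>0\<close> lasts at least \<open>4 h\<close>. A window
  of length \<open>4 h\<close> contains three full cells of the grid of mesh \<open>h\<close>, wherever it starts.
  In the slope \<open>\<bar>d\<bar> + 12 \<mu>\<close> the summand \<open>12 \<mu> h = 3 \<epsilon>\<close> is made of \<open>\<epsilon>\<close> for the change of \<open>G\<close> and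
  \<open>2 \<epsilon>\<close> for the growth of \<open>A\<close> and \<open>\<Gamma>\<close>.\<close>

lemma collapse_slows_driver:
  fixes A \<Gamma> G S w :: "real \<Rightarrow> real" and \<mu> c d h s\<^sub>0 \<nu> \<tau> :: real
  assumes A: "mono_on {0..} A" and \<Gamma>: "mono_on {0..} \<Gamma>"
    and cont: "continuous_on {0..} S"
    and S: "\<And>t. 0 \<le> t \<Longrightarrow> S t = s\<^sub>0 - \<nu> * t + (A t + \<Gamma> t) / 2"
    and G: "\<And>t. 0 \<le> t \<Longrightarrow> G t = c + d * t - w t + A t - \<Gamma> t / 2"
    and GS: "\<And>t. 0 \<le> t \<Longrightarrow> 0 \<le> G t \<and> G t \<le> S t"
    and \<mu>: "0 < \<mu>" "\<nu> \<le> \<mu>" and h: "0 < h" "4 * \<mu> * h \<le> S 0"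
    and \<tau>: "0 \<le> \<tau>" "S \<tau> \<le> 0"
  shows "\<exists>i::nat. real i * h \<le> \<tau> \<and>
    (\<forall>j<3. \<bar>w (real i * h + real (Suc j) * h) - w (real i * h + real j * h)\<bar>
       \<le> (\<bar>d\<bar> + 12 * \<mu>) * h)"
proof -
  define \<epsilon> where "\<epsilon> = 4 * \<mu> * h"
  have "0 < \<epsilon>" using \<mu> h by (simp add: \<epsilon>_def)
  have monoA: "A s \<le> A t" and mono\<Gamma>: "\<Gamma> s \<le> \<Gamma> t" if "0 \<le> s" "s \<le> t" for s t
    using that A \<Gamma> by (auto simp: mono_on_def)
  have "continuous_on {0..\<tau>} S"
    by (rule continuous_on_subset[OF cont]) auto
  then obtain a where a: "a \<in> {0..\<tau>}" "S a = \<epsilon>" and le: "\<And>t. t \<in> {a..\<tau>} \<Longrightarrow> S t \<le> \<epsilon>"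
    using \<tau> h \<open>0 < \<epsilon>\<close> by (elim last_passage[where \<epsilon> = \<epsilon>]) (auto simp: \<epsilon>_def)
  have "0 \<le> a" "a \<le> \<tau>" using a by auto
  then have "A a \<le> A \<tau>" "\<Gamma> a \<le> \<Gamma> \<tau>"
    using monoA mono\<Gamma> by blast+
  then have "\<epsilon> \<le> \<nu> * \<tau> - \<nu> * a"
    using S[OF \<open>0 \<le> a\<close>] S[OF \<tau>(1)] \<open>S a = \<epsilon>\<close> \<tau>(2) by argo
  also have "\<dots> = \<nu> * (\<tau> - a)"
    by (simp add: algebra_simps)
  also have "\<dots> \<le> \<mu> * (\<tau> - a)"
    using a \<mu> by (intro mult_right_mono) auto
  finally have "4 * h \<le> \<tau> - a"
    using \<mu> by (simp add: \<epsilon>_def)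
  then have sub: "a + 4 * h \<le> \<tau>" by simp
  have step: "\<bar>w (s + h) - w s\<bar> \<le> (\<bar>d\<bar> + 12 * \<mu>) * h" if s: "a \<le> s" "s + h \<le> a + 4 * h" for s
  proof -
    have pos: "0 \<le> a" "0 \<le> s" "0 \<le> s + h"
      using a s h by auto
    \<comment> \<open>As \<open>S\<close> does not exceed its value at \<open>a\<close>, the upward push only compensates the drift.\<close>
    have "(A (s + h) + \<Gamma> (s + h) - A a - \<Gamma> a) / 2 = S (s + h) - S a + \<nu> * (s + h - a)"
      using S[of a] S[of "s + h"] pos by (simp add: field_simps)
    also have "\<dots> \<le> \<nu> * (s + h - a)"
      using le[of "s + h"] a sub s h by simp
    also have "\<dots> \<le> \<mu> * (4 * h)"
      using \<mu> s h by (intro mult_mono) auto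
    finally have push: "A (s + h) + \<Gamma> (s + h) - A a - \<Gamma> a \<le> 2 * \<epsilon>"
      by (simp add: \<epsilon>_def)
    have "w (s + h) - w s = d * h - (G (s + h) - G s)
        + ((A (s + h) - A s) - (\<Gamma> (s + h) - \<Gamma> s) / 2)"
      using G[of s] G[of "s + h"] pos by (simp add: field_simps)
    moreover have "\<bar>d * h\<bar> = \<bar>d\<bar> * h"
      using h by (simp add: abs_mult)
    moreover have "\<bar>G (s + h) - G s\<bar> \<le> \<epsilon>"
      using GS[of s] GS[of "s + h"] le[of s] le[of "s + h"] pos sub s h by auto
    moreover have "\<bar>(A (s + h) - A s) - (\<Gamma> (s + h) - \<Gamma> s) / 2\<bar> \<le> 2 * \<epsilon>"
    proof -
      have "A a \<le> A s" "\<Gamma> a \<le> \<Gamma> s" "A s \<le> A (s + h)" "\<Gamma> s \<le> \<Gamma> (s + h)"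
        using pos s h by (auto intro: monoA mono\<Gamma>)
      then have "0 \<le> A (s + h) - A s" "0 \<le> \<Gamma> (s + h) - \<Gamma> s"
        and "A (s + h) - A s + (\<Gamma> (s + h) - \<Gamma> s) \<le> 2 * \<epsilon>"
        using push by linarith+
      then show ?thesis
        by (simp add: abs_le_iff) argo
    qed
    ultimately have "\<bar>w (s + h) - w s\<bar> \<le> \<bar>d\<bar> * h + \<epsilon> + 2 * \<epsilon>"
      by linarith
    then show ?thesis
      by (simp add: \<epsilon>_def algebra_simps)
  qed
  \<comment> \<open>The first grid point at or after \<open>a\<close>; the cells \<open>i\<close>, \<open>i + 1\<close>, \<open>i + 2\<close> end before \<open>a + 4 h\<close>.\<close>
  define i where "i = nat \<lceil>a / h\<rceil>"
  have "0 \<le> a / h" using a h by simp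
  then have "a / h \<le> real i" "real i < a / h + 1"
    unfolding i_def by linarith+
  then have i: "a \<le> real i * h" "real i * h < a + h"
    using h by (simp_all add: field_simps)
  show ?thesis
  proof (intro exI[of _ i] conjI allI impI)
    show "real i * h \<le> \<tau>"
      using i sub h by linarith
    fix j :: nat assume "j < 3"
    then have j: "real j * h \<le> 2 * h" "0 \<le> real j * h"
      using h by auto
    have "real i * h + real (Suc j) * h = (real i * h + real j * h) + h"
      by (simp add: algebra_simps)
    moreover have "a \<le> real i * h + real j * h" "real i * h + real j * h + h \<le> a + 4 * h"
      using i j by linarith+
    ultimately show "\<bar>w (real i * h + real (Suc j) * h) - w (real i * h + real j * h)\<bar>
        \<le> (\<bar>d\<bar> + 12 * \<mu>) * h"
      using step by (simp only:)
  qed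
qed

section \<open>Absence of triple collisions\<close>

text \<open>Continuity makes the running supremum finite, which is what turns the equations for \<open>A\<close> and
  \<open>\<Gamma>\<close> into nonnegativity of the gaps.\<close>

lemma le_running_SUP:
  fixes f :: "real \<Rightarrow> real"
  assumes "continuous_on {0..} f" "0 \<le> t"
  shows "f t \<le> (SUP s\<in>{0..t}. max 0 (f s))"
proof -
  have "compact ((\<lambda>s. max 0 (f s)) ` {0..t})"
    using continuous_on_subset[OF assms(1), of "{0..t}"]
    by (intro compact_continuous_image continuous_intros) auto
  then have "bdd_above ((\<lambda>s. max 0 (f s)) ` {0..t})"
    by (intro bounded_imp_bdd_above compact_imp_bounded)
  then have "max 0 (f t) \<le> (SUP s\<in>{0..t}. max 0 (f s))"
    using assms(2) by (intro cSUP_upper) auto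
  then show ?thesis by simp
qed

theorem proposition2p1:
  fixes M :: "'a measure" and W A \<Gamma> R\<^sub>1 R\<^sub>2 R\<^sub>3 G H :: "real \<Rightarrow> 'a \<Rightarrow> real"
    and \<delta>\<^sub>1 \<delta>\<^sub>2 \<delta>\<^sub>3 x\<^sub>1 x\<^sub>2 x\<^sub>3 :: real
  assumes "x\<^sub>1 > x\<^sub>2" and "x\<^sub>2 > x\<^sub>3"
    and "standard_brownian_motion M W"
    and "regulator_pair M W \<delta>\<^sub>1 \<delta>\<^sub>2 \<delta>\<^sub>3 x\<^sub>1 x\<^sub>2 x\<^sub>3 A \<Gamma>"
  defines "R\<^sub>1 \<equiv> R1 \<delta>\<^sub>1 x\<^sub>1 A" and "R\<^sub>2 \<equiv> R2 W \<delta>\<^sub>2 x\<^sub>2 A \<Gamma>" and "R\<^sub>3 \<equiv> R3 \<delta>\<^sub>3 x\<^sub>3 \<Gamma>"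
    and "G \<equiv> gap R\<^sub>1 R\<^sub>2" and "H \<equiv> gap R\<^sub>2 R\<^sub>3"
  shows "AE \<omega> in M. \<forall>t\<ge>0. R\<^sub>1 t \<omega> - R\<^sub>3 t \<omega> = G t \<omega> + H t \<omega> \<and> G t \<omega> + H t \<omega> > 0"
proof -
  interpret standard_brownian_motion M W by fact
  note defs = R\<^sub>1_def R\<^sub>2_def R\<^sub>3_def G_def H_def gap_def R1_def R2_def R3_def
  \<comment> \<open>The summand \<open>1\<close> keeps \<open>\<mu>\<close> positive when \<open>\<delta>\<^sub>1 = \<delta>\<^sub>3\<close>.\<close>
  define \<mu> where "\<mu> = \<bar>\<delta>\<^sub>3 - \<delta>\<^sub>1\<bar> + 1"
  define C where "C = \<bar>\<delta>\<^sub>1 - \<delta>\<^sub>2\<bar> + 12 * \<mu>"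
  have \<mu>: "0 < \<mu>" "\<delta>\<^sub>3 - \<delta>\<^sub>1 \<le> \<mu>" by (auto simp: \<mu>_def)
  have "0 \<le> C" using \<mu> by (simp add: C_def)
  note reg = assms(4)[unfolded regulator_pair_def, THEN conjunct2, THEN conjunct2]
  from reg continuous_W AE_not_eventually_slow[OF \<open>0 \<le> C\<close>] AE_space show ?thesis
  proof eventually_elim
    case (elim \<omega>)
    then have cA: "continuous_on {0..} (\<lambda>t. A t \<omega>)" and mA: "mono_on {0..} (\<lambda>t. A t \<omega>)"
      and c\<Gamma>: "continuous_on {0..} (\<lambda>t. \<Gamma> t \<omega>)" and m\<Gamma>: "mono_on {0..} (\<lambda>t. \<Gamma> t \<omega>)"
      and zero: "A 0 \<omega> = 0" "\<Gamma> 0 \<omega> = 0"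
      and cW: "continuous_on {0..} (\<lambda>t. W t \<omega>)"
      and slow: "\<And>m N. \<exists>n\<ge>N. \<omega> \<notin> slow_near C (real m) (1 / real (Suc n))"
      and \<omega>: "\<omega> \<in> space M"
      and A_eq: "\<And>t. 0 \<le> t \<Longrightarrow> A t \<omega> = (SUP s\<in>{0..t}.
            max 0 (- (x\<^sub>1 - x\<^sub>2) + (\<delta>\<^sub>2 - \<delta>\<^sub>1) * s + W s \<omega> + \<Gamma> s \<omega> / 2))"
      and \<Gamma>_eq: "\<And>t. 0 \<le> t \<Longrightarrow> \<Gamma> t \<omega> = (SUP s\<in>{0..t}.
            max 0 (- (x\<^sub>2 - x\<^sub>3) + (\<delta>\<^sub>3 - \<delta>\<^sub>2) * s - W s \<omega> + A s \<omega> / 2))"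
      by blast+
    have gaps: "0 \<le> G t \<omega>" "0 \<le> H t \<omega>" if t: "0 \<le> t" for t
    proof -
      have "- (x\<^sub>1 - x\<^sub>2) + (\<delta>\<^sub>2 - \<delta>\<^sub>1) * t + W t \<omega> + \<Gamma> t \<omega> / 2 \<le> A t \<omega>"
        unfolding A_eq[OF t] by (intro le_running_SUP continuous_intros cW c\<Gamma> t) auto
      then show "0 \<le> G t \<omega>"
        by (simp add: defs algebra_simps)
      have "- (x\<^sub>2 - x\<^sub>3) + (\<delta>\<^sub>3 - \<delta>\<^sub>2) * t - W t \<omega> + A t \<omega> / 2 \<le> \<Gamma> t \<omega>"
        unfolding \<Gamma>_eq[OF t] by (intro le_running_SUP continuous_intros cW cA t) auto
      then show "0 \<le> H t \<omega>"
        by (simp add: defs algebra_simps)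
    qed
    let ?S = "\<lambda>t. G t \<omega> + H t \<omega>"
    have S: "?S t = (x\<^sub>1 - x\<^sub>3) - (\<delta>\<^sub>3 - \<delta>\<^sub>1) * t + (A t \<omega> + \<Gamma> t \<omega>) / 2" for t
      by (simp add: defs field_simps)
    have "0 < ?S t" if t: "0 \<le> t" for t
    proof (rule ccontr)
      assume collapse: "\<not> 0 < ?S t"
      obtain m :: nat where m: "t \<le> real m"
        using real_arch_simple by blast
      \<comment> \<open>The mesh must be so fine that \<open>S\<close> starts above the level \<open>4 \<mu> h\<close>.\<close>
      have "0 < (x\<^sub>1 - x\<^sub>3) / (4 * \<mu>)"
        using assms(1,2) \<mu> by simp
      then obtain N where N: "1 / real (Suc N) < (x\<^sub>1 - x\<^sub>3) / (4 * \<mu>)"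
        using nat_approx_posE by metis
      obtain n where "n \<ge> N" and n: "\<omega> \<notin> slow_near C (real m) (1 / real (Suc n))"
        using slow by blast
      define h where "h = 1 / real (Suc n)"
      have "h \<le> 1 / real (Suc N)"
        using \<open>n \<ge> N\<close> by (simp add: h_def frac_le)
      with N have "h < (x\<^sub>1 - x\<^sub>3) / (4 * \<mu>)" by simp
      then have small: "4 * \<mu> * h \<le> ?S 0"
        using \<mu> by (simp add: S zero field_simps)
      have "\<exists>i::nat. real i * h \<le> t \<and>
        (\<forall>j<3. \<bar>W (real i * h + real (Suc j) * h) \<omega> - W (real i * h + real j * h) \<omega>\<bar>
           \<le> (\<bar>\<delta>\<^sub>1 - \<delta>\<^sub>2\<bar> + 12 * \<mu>) * h)"
      proof (rule collapse_slows_driver[OF mA m\<Gamma> _ S, where G = "\<lambda>t. G t \<omega>" and c = "x\<^sub>1 - x\<^sub>2"])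
        show "continuous_on {0..} ?S"
          unfolding S by (intro continuous_intros cA c\<Gamma>) auto
        show "G t \<omega> = x\<^sub>1 - x\<^sub>2 + (\<delta>\<^sub>1 - \<delta>\<^sub>2) * t - W t \<omega> + A t \<omega> - \<Gamma> t \<omega> / 2" for t
          by (simp add: defs field_simps)
      qed (use gaps \<mu> small t collapse in \<open>auto simp: h_def\<close>)
      then have "\<omega> \<in> slow_near C (real m) h"
        using m \<omega> unfolding slow_near_def C_def by (blast intro: order_trans)
      with n show False
        by (simp add: h_def)
    qed
    moreover have "R\<^sub>1 t \<omega> - R\<^sub>3 t \<omega> = ?S t" for t
      by (simp add: G_def H_def gap_def)
    ultimately show ?case by blast
  qed
qed

end
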